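(* Let $W$ be a positive integer (the window size) and $\varepsilon$ a real parameter with $\varepsilon > \frac{2}{W}$. Let $\mathcal{A}$ be a frame-based sliding-window algorithm that solves the $(W,\varepsilon - \frac{2}{W})$-WFrequency problem. Then the learning-augmented algorithm LWCSS built on top of $\mathcal{A}$ (as described in the context) solves the $(W,\varepsilon)$-WFrequency problem, regardless of the accuracy of the predictor it uses. That is, for every item $i$ and every query time, its answer $\widehat{f_i^{W}}$ satisfies $f_i^{W} \le \widehat{f_i^{W}} \le f_i^{W} + \varepsilon W$.
   Context: A stream $\mathcal{S}=u_1,u_2,\ldots$ is a finite sequence of items from a universe $\mathcal{U}$. For an item $i$, $f_i^{W}$ denotes the number of occurrences of $i$ among the last $W$ arrivals of the stream. A streaming algorithm supports ADD$(i)$ (append $i$ to the stream) and Query$(i)$ (return an estimate $\widehat{f_i^{W}}$ of $f_i^{W}$). An algorithm solves the $(W,\epsilon)$-WFrequency problem if every Query$(i)$ returns $\widehat{f_i^{W}}$ with $f_i^{W} \le \widehat{f_i^{W}} \le f_i^{W} + W\epsilon$. Standing setup: the stream is divided into consecutive, disjoint frames of $W$ arrivals each, so that any window of $W$ consecutive arrivals intersects at most two frames; $\mathcal{A}$ is a sliding-window algorithm following this frame division (e.g. Window Compact Space-Saving). LWCSS: it maintains an instance of $\mathcal{A}$ and a Bloom filter (a set-membership structure with no false negatives, possibly with false positives), the Bloom filter being reset to empty at the beginning of each frame. It uses a predictor (an arbitrary, possibly erroneous black box) which, on each arrival of an item $i$, predicts whether the next arrival of $i$ occurs within the next $W$ arrivals.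 On an arrival of item $i$: if the predictor says the next arrival of $i$ is within $W$ arrivals, $i$ is inserted into $\mathcal{A}$; otherwise, if the Bloom filter reports that it contains $i$, $i$ is inserted into $\mathcal{A}$; otherwise $i$ is added to the Bloom filter and not inserted into $\mathcal{A}$. The time/frame bookkeeping of $\mathcal{A}$ advances with every arrival. On Query$(i)$, LWCSS returns $\mathcal{A}.\mathrm{Query}(i) + 2$.
   Formalization: The guarantee assumed of A is required also for histories in which some arrivals only advance its time and frame bookkeeping without being inserted (they occupy window positions but count for no item); with the guarantee only for fully inserted streams the claim can fail. *)

theory Defs
  imports Complex_Main
begin

text \<open>The universe of items is the type \<^typ>\<open>'a\<close>; streams are lists, latest arrival last.\<close>

record ('a, 's) stream_alg =
  init :: 's
  add :: "'a \<Rightarrow> 's \<Rightarrow> 's"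
  query :: "'s \<Rightarrow> 'a \<Rightarrow> real"

definition run :: "('a, 's, 'm) stream_alg_scheme \<Rightarrow> 'a list \<Rightarrow> 's" where
  "run A us = fold (add A) us (init A)"

text \<open>If fewer than \<open>W\<close> items have arrived, the window is the whole stream.\<close>

definition window :: "nat \<Rightarrow> 'u list \<Rightarrow> 'u list" where
  "window W us = drop (length us - W) us"

definition wfreq :: "nat \<Rightarrow> 'u list \<Rightarrow> 'u \<Rightarrow> nat" where
  "wfreq W us i = count_list (window W us) i"

definition within_error :: "nat \<Rightarrow> real \<Rightarrow> nat \<Rightarrow> real \<Rightarrow> bool" where
  "within_error W \<epsilon> f est \<longleftrightarrow> real f \<le> est \<and> est \<le> real f + real W * \<epsilon>"

definition solves_WFrequency ::
  "nat \<Rightarrow> real \<Rightarrow> ('a, 's, 'm) stream_alg_scheme \<Rightarrow> bool" where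
  "solves_WFrequency W \<epsilon> A \<longleftrightarrow>
     (\<forall>us i. within_error W \<epsilon> (wfreq W us i) (query A (run A us) i))"

text \<open>
  A frame-based algorithm can also let one arrival pass without inserting it: \<open>advance\<close> moves
  only the time and frame bookkeeping. The history of such an algorithm is a list over
  \<^typ>\<open>'a option\<close>, where \<^term>\<open>Some i\<close> is an arrival inserted as \<open>i\<close> and \<^term>\<open>None\<close> an arrival
  that was not inserted; both kinds of arrivals count towards the window and the frame.
  The field \<open>frame_pos\<close> is the number of arrivals of the current frame seen so far, so it is
  \<open>0\<close> exactly if the next arrival begins a new frame.
\<close>

record ('a, 's) frame_alg = "('a, 's) stream_alg" +
  advance :: "'s \<Rightarrow> 's"
  frame_pos :: "'s \<Rightarrow> nat"

definition step_gaps :: "('a, 's, 'm) frame_alg_scheme \<Rightarrow> 'a option \<Rightarrow> 's \<Rightarrow> 's" where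
  "step_gaps A x = (case x of None \<Rightarrow> advance A | Some i \<Rightarrow> add A i)"

definition run_gaps :: "('a, 's, 'm) frame_alg_scheme \<Rightarrow> 'a option list \<Rightarrow> 's" where
  "run_gaps A xs = fold (step_gaps A) xs (init A)"

definition frame_based :: "nat \<Rightarrow> ('a, 's, 'm) frame_alg_scheme \<Rightarrow> bool" where
  "frame_based W A \<longleftrightarrow> (\<forall>xs. frame_pos A (run_gaps A xs) = length xs mod W)"

text \<open>The same problem for histories in which some arrivals were not inserted.\<close>

definition solves_WFrequency_gaps ::
  "nat \<Rightarrow> real \<Rightarrow> ('a, 's, 'm) frame_alg_scheme \<Rightarrow> bool" where
  "solves_WFrequency_gaps W \<epsilon> A \<longleftrightarrow>
     (\<forall>xs i. within_error W \<epsilon> (wfreq W xs (Some i)) (query A (run_gaps A xs) i))"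

lemma run_gaps_map_Some: "run_gaps A (map Some us) = run A us"
  by (simp add: run_gaps_def run_def fold_map comp_def step_gaps_def)

lemma wfreq_map_Some: "wfreq W (map Some us) (Some i) = wfreq W us i"
proof -
  have "count_list (map Some xs) (Some i) = count_list xs i" for xs
    by (induction xs) auto
  then show ?thesis
    by (simp add: wfreq_def window_def drop_map)
qed

lemma solves_WFrequency_gapsD:
  "solves_WFrequency_gaps W \<epsilon> A \<Longrightarrow> solves_WFrequency W \<epsilon> A"
  unfolding solves_WFrequency_gaps_def solves_WFrequency_def
  by (metis run_gaps_map_Some wfreq_map_Some)

record ('a, 'b) membership_filter =
  bf_empty :: 'b
  bf_insert :: "'a \<Rightarrow> 'b \<Rightarrow> 'b"
  bf_member :: "'b \<Rightarrow> 'a \<Rightarrow> bool"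

definition no_false_negatives :: "('a, 'b) membership_filter \<Rightarrow> bool" where
  "no_false_negatives B \<longleftrightarrow>
     (\<forall>xs. \<forall>x\<in>set xs. bf_member B (fold (bf_insert B) xs (bf_empty B)) x)"

text \<open>
  The standard Bloom filter is an instance: its state is the set of positions whose bit is set,
  and \<open>h x\<close> is the set of positions to which the hash functions map \<open>x\<close>.
\<close>

definition bloom_filter :: "('a \<Rightarrow> nat set) \<Rightarrow> ('a, nat set) membership_filter" where
  "bloom_filter h =
     \<lparr>bf_empty = {}, bf_insert = (\<lambda>x b. h x \<union> b), bf_member = (\<lambda>b x. h x \<subseteq> b)\<rparr>"

lemma no_false_negatives_bloom_filter: "no_false_negatives (bloom_filter h)"
proof -
  have "fold (\<lambda>x b. h x \<union> b) xs b = b \<union> (\<Union>x\<in>set xs. h x)" for xs b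
    by (induction xs arbitrary: b) auto
  then show ?thesis
    by (auto simp: no_false_negatives_def bloom_filter_def)
qed

text \<open>
  A predictor is an arbitrary automaton that answers on each arrival; the answer \<open>True\<close> predicts
  that the item arrives again within the next \<open>W\<close> arrivals. No relation between the answers and
  the stream is required, and since the state type is arbitrary, any sequence of answers can occur.
\<close>

record ('a, 'p) predictor =
  p_init :: 'p
  p_step :: "'a \<Rightarrow> 'p \<Rightarrow> bool \<times> 'p"

fun lwcss_add ::
  "('a, 's) frame_alg \<Rightarrow> ('a, 'b) membership_filter \<Rightarrow> ('a, 'p) predictor \<Rightarrow>
     'a \<Rightarrow> 's \<times> 'b \<times> 'p \<Rightarrow> 's \<times> 'b \<times> 'p" where
  "lwcss_add A B P i (s, b, p) =
     (let b' = (if frame_pos A s = 0 then bf_empty B else b);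
          (soon, p') = p_step P i p
      in if soon then (add A i s, b', p')
         else if bf_member B b' i then (add A i s, b', p')
         else (advance A s, bf_insert B i b', p'))"

definition lwcss ::
  "('a, 's) frame_alg \<Rightarrow> ('a, 'b) membership_filter \<Rightarrow> ('a, 'p) predictor \<Rightarrow>
     ('a, 's \<times> 'b \<times> 'p) stream_alg" where
  "lwcss A B P =
     \<lparr>init = (init A, bf_empty B, p_init P),
      add = lwcss_add A B P,
      query = (\<lambda>(s, b, p) i. query A s i + 2)\<rparr>"

end

theory Submission
  imports Defs
begin

text \<open>
  Replace every arrival that LWCSS does not insert by a gap. Within a frame an item is left out
  at most once, since the Bloom filter has no false negatives and is only reset between frames.
  A window meets at most two frames, so the frequencies in the stream and in the history with
  gaps differ by at most 2; this is what the \<open>+ 2\<close> in the query and the \<open>2 / W\<close> in the error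
  of the underlying algorithm compensate.
\<close>

text \<open>\<open>xs\<close> is the history that the underlying algorithm sees for the stream
  \<open>us\<close>. Positions count from 0, so \<open>j div W\<close> is the index of the frame of
  arrival \<open>j\<close>.\<close>

definition thinning :: "nat \<Rightarrow> 'a list \<Rightarrow> 'a option list \<Rightarrow> bool" where
  "thinning W us xs \<longleftrightarrow>
     length xs = length us \<and>
     (\<forall>j<length us. xs ! j = None \<or> xs ! j = Some (us ! j)) \<and>
     (\<forall>k<length us. \<forall>j<k. xs ! j = None \<longrightarrow> xs ! k = None \<longrightarrow> us ! j = us ! k \<longrightarrow>
        j div W \<noteq> k div W)"

text \<open>Absolute positions make occurrences in \<open>us\<close> and \<open>xs\<close>
  comparable and reveal their frames.\<close>

lemma wfreq_eq_card:
  "wfreq W us i = card {j \<in> {length us - W..<length us}. us ! j = i}"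
proof -
  let ?m = "length us - W"
  have "wfreq W us i = card {k. k < length us - ?m \<and> us ! (?m + k) = i}"
    unfolding wfreq_def window_def count_list_eq_length_filter length_filter_conv_card
    by (intro arg_cong[where f = card]) auto
  also have "\<dots> = card ((+) ?m ` {k. k < length us - ?m \<and> us ! (?m + k) = i})"
    by (simp add: card_image)
  also have "(+) ?m ` {k. k < length us - ?m \<and> us ! (?m + k) = i} =
      {j \<in> {?m..<length us}. us ! j = i}"
  proof (intro equalityI subsetI)
    fix j assume "j \<in> {j \<in> {?m..<length us}. us ! j = i}"
    then show "j \<in> (+) ?m ` {k. k < length us - ?m \<and> us ! (?m + k) = i}"
      by (intro image_eqI[where x = "j - ?m"]) auto
  qed auto
  finally show ?thesis .
qed

text \<open>At most \<open>W\<close> consecutive positions meet at most two frames, and injectivity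
  allows one element of \<open>K\<close> in each.\<close>

lemma card_le_2_if_div_inj_on_window:
  fixes W n :: nat
  assumes "W > 0" and K: "K \<subseteq> {n - W..<n}" and inj: "inj_on (\<lambda>j. j div W) K"
  shows "card K \<le> 2"
proof -
  let ?q = "(n - W) div W"
  have "j div W \<in> {?q, Suc ?q}" if "j \<in> K" for j
  proof -
    \<comment> \<open>The bound \<open>n - W + W\<close> instead of \<open>n\<close> also covers
      \<open>n < W\<close>, where the subtraction truncates to 0.\<close>
    have j: "n - W \<le> j" "j < n - W + W"
      using subsetD[OF K that] by auto
    have "?q \<le> j div W"
      using j by (simp add: div_le_mono)
    moreover have "j div W \<le> (n - W + W) div W"
      by (intro div_le_mono less_imp_le j(2))
    ultimately show ?thesis
      using \<open>W > 0\<close> by auto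
  qed
  then have "card ((\<lambda>j. j div W) ` K) \<le> card {?q, Suc ?q}"
    by (intro card_mono) auto
  then show ?thesis
    using inj by (simp add: card_image)
qed

text \<open>The occurrences \<open>?F\<close> of \<open>i\<close> in the window split into the
  inserted ones \<open>?G\<close> and the omitted ones \<open>?K\<close>; the latter lie in distinct
  frames.\<close>

lemma wfreq_thinning:
  assumes "W > 0" and thin: "thinning W us xs"
  shows "wfreq W xs (Some i) \<le> wfreq W us i" and "wfreq W us i \<le> wfreq W xs (Some i) + 2"
proof -
  let ?I = "{length us - W..<length us}"
  let ?F = "{j \<in> ?I. us ! j = i}"
  let ?G = "{j \<in> ?I. xs ! j = Some i}"
  let ?K = "{j \<in> ?I. us ! j = i \<and> xs ! j = None}"
  have len: "length xs = length us"
    and cases: "\<And>j. j < length us \<Longrightarrow> xs ! j = None \<or> xs ! j = Some (us ! j)"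
    and once: "\<And>j k. k < length us \<Longrightarrow> j < k \<Longrightarrow> xs ! j = None \<Longrightarrow> xs ! k = None \<Longrightarrow>
      us ! j = us ! k \<Longrightarrow> j div W \<noteq> k div W"
    using thin by (auto simp: thinning_def)
  have F: "wfreq W us i = card ?F" and G: "wfreq W xs (Some i) = card ?G"
    by (simp_all add: wfreq_eq_card len)
  have "?G \<subseteq> ?F"
    using cases by fastforce
  then show "wfreq W xs (Some i) \<le> wfreq W us i"
    unfolding F G by (intro card_mono) auto
  have "inj_on (\<lambda>j. j div W) ?K"
  proof (rule linorder_inj_onI)
    fix j k assume "j < k" "j \<in> ?K" "k \<in> ?K"
    then show "j div W \<noteq> k div W"
      by (intro once) auto
  qed auto
  then have "card ?K \<le> 2"
    by (intro card_le_2_if_div_inj_on_window[OF \<open>W > 0\<close>]) auto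
  moreover have "card ?F \<le> card (?G \<union> ?K)"
    using cases by (intro card_mono) fastforce+
  moreover have "card (?G \<union> ?K) \<le> card ?G + card ?K"
    by (rule card_Un_le)
  ultimately show "wfreq W us i \<le> wfreq W xs (Some i) + 2"
    unfolding F G by linarith
qed

lemma thinning_snoc_Some:
  "thinning W us xs \<Longrightarrow> thinning W (us @ [u]) (xs @ [Some u])"
  by (auto simp: thinning_def nth_append less_Suc_eq)

lemma thinning_snoc_None:
  assumes "thinning W us xs"
    and "\<And>j. j < length us \<Longrightarrow> xs ! j = None \<Longrightarrow> us ! j = u \<Longrightarrow> j div W \<noteq> length us div W"
  shows "thinning W (us @ [u]) (xs @ [None])"
  unfolding thinning_def
proof (intro conjI allI impI)
  fix k j
  assume "k < length (us @ [u])" "j < k" "(xs @ [None]) ! j = None" "(xs @ [None]) ! k = None"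
    "(us @ [u]) ! j = (us @ [u]) ! k"
  then show "j div W \<noteq> k div W"
    using assms by (cases "k = length us") (simp_all add: thinning_def nth_append)
qed (use assms in \<open>auto simp: thinning_def nth_append\<close>)

lemma run_snoc: "run A (us @ [u]) = add A u (run A us)"
  by (simp add: run_def)

lemma run_gaps_snoc: "run_gaps A (xs @ [x]) = step_gaps A x (run_gaps A xs)"
  by (simp add: run_gaps_def)

text \<open>
  The list \<open>ys\<close> records the items put into the filter since its last reset. The reset takes
  place at the first arrival of a new frame, so between two frames \<open>ys\<close> is stale; the last
  clause is then vacuous.
\<close>

lemma run_lwcss:
  assumes frame: "frame_based W A" and nfn: "no_false_negatives B"
  shows "\<exists>xs ys p. thinning W us xs \<and>
    run (lwcss A B P) us = (run_gaps A xs, fold (bf_insert B) ys (bf_empty B), p) \<and>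
    (\<forall>j<length us. xs ! j = None \<longrightarrow> j div W = length us div W \<longrightarrow> us ! j \<in> set ys)"
proof (induction us rule: rev_induct)
  case Nil
  have "run (lwcss A B P) [] = (run_gaps A [], fold (bf_insert B) [] (bf_empty B), p_init P)"
    by (simp add: run_def run_gaps_def lwcss_def)
  then show ?case
    by (intro exI[of _ "[]"] exI[of _ "p_init P"]) (simp add: thinning_def)
next
  case (snoc u us)
  then obtain xs ys p where thin: "thinning W us xs"
    and run: "run (lwcss A B P) us = (run_gaps A xs, fold (bf_insert B) ys (bf_empty B), p)"
    and ys: "\<And>j. j < length us \<Longrightarrow> xs ! j = None \<Longrightarrow> j div W = length us div W \<Longrightarrow>
      us ! j \<in> set ys"
    by blast
  let ?n = "length us"
  let ?s = "run_gaps A xs"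
  let ?fill = "\<lambda>ys. fold (bf_insert B) ys (bf_empty B)"
  have len: "length xs = ?n"
    using thin by (simp add: thinning_def)
  \<comment> \<open>LWCSS resets the filter before consulting it, so \<open>ys'\<close> describes
    the filter that \<open>u\<close> is tested against.\<close>
  define ys' where "ys' = (if ?n mod W = 0 then [] else ys)"
  obtain soon p' where step: "p_step P u p = (soon, p')"
    by fastforce
  have pos: "frame_pos A ?s = ?n mod W"
    using frame len by (simp add: frame_based_def)
  have run': "run (lwcss A B P) (us @ [u]) =
      (if soon \<or> bf_member B (?fill ys') u then (run_gaps A (xs @ [Some u]), ?fill ys', p')
       else (run_gaps A (xs @ [None]), ?fill (ys' @ [u]), p'))"
    unfolding run_snoc run
    by (simp add: lwcss_def run_gaps_snoc step_gaps_def step pos ys'_def Let_def)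
  \<comment> \<open>The reset loses nothing: if \<open>?n\<close> starts a frame, no earlier
    position shares it.\<close>
  have ys': "us ! j \<in> set ys'" if "j < ?n" "xs ! j = None" "j div W = ?n div W" for j
  proof -
    have "?n mod W \<noteq> 0"
    proof
      assume "?n mod W = 0"
      then have "?n = W * (j div W)"
        using that(3) by (metis add_0_right mult_div_mod_eq)
      then show False
        using that(1) times_div_less_eq_dividend[of W j] by linarith
    qed
    then show ?thesis
      using ys that by (simp add: ys'_def)
  qed
  \<comment> \<open>The new invariant refers to the frame of \<open>Suc ?n\<close>;
    \<open>?n\<close> lies between \<open>j\<close> and \<open>Suc ?n\<close>, hence in the same
    frame.\<close>
  have same_frame: "j div W = ?n div W" if "j < ?n" "j div W = Suc ?n div W" for j
    using that div_le_mono[of j ?n W] div_le_mono[of ?n "Suc ?n" W] by linarith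
  show ?case
  proof (cases "soon \<or> bf_member B (?fill ys') u")
    case True
    have "\<forall>j<length (us @ [u]). (xs @ [Some u]) ! j = None \<longrightarrow>
        j div W = length (us @ [u]) div W \<longrightarrow> (us @ [u]) ! j \<in> set ys'"
      using ys' same_frame len by (auto simp: nth_append less_Suc_eq)
    then show ?thesis
      using thinning_snoc_Some[OF thin] run' True
      by (intro exI[of _ "xs @ [Some u]"] exI[of _ ys'] exI[of _ p'] conjI) simp_all
  next
    case False
    \<comment> \<open>A negative answer of the filter is reliable, so by the invariant
      \<open>u\<close> was not yet omitted in this frame.\<close>
    have "u \<notin> set ys'"
      using False nfn by (auto simp: no_false_negatives_def)
    then have "thinning W (us @ [u]) (xs @ [None])"
      using ys' by (intro thinning_snoc_None[OF thin]) auto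
    moreover have "\<forall>j<length (us @ [u]). (xs @ [None]) ! j = None \<longrightarrow>
        j div W = length (us @ [u]) div W \<longrightarrow> (us @ [u]) ! j \<in> set (ys' @ [u])"
      using ys' same_frame len by (auto simp: nth_append less_Suc_eq)
    ultimately show ?thesis
      using run' False
      by (intro exI[of _ "xs @ [None]"] exI[of _ "ys' @ [u]"] exI[of _ p'] conjI) simp_all
  qed
qed

theorem theorem1:
  fixes W :: nat and \<epsilon> :: real
    and A :: "('a, 's) frame_alg"
    and B :: "('a, 'b) membership_filter"
    and P :: "('a, 'p) predictor"
  assumes "W > 0"
    and "\<epsilon> > 2 / real W"
    and "frame_based W A"
    and "solves_WFrequency_gaps W (\<epsilon> - 2 / real W) A"
    and "no_false_negatives B"
  shows "solves_WFrequency W \<epsilon> (lwcss A B P)"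
  unfolding solves_WFrequency_def
proof (intro allI)
  fix us :: "'a list" and i :: 'a
  obtain xs b p where thin: "thinning W us xs"
    and run: "run (lwcss A B P) us = (run_gaps A xs, b, p)"
    using run_lwcss[OF assms(3,5), of us P] by (elim exE conjE)
  have query: "query (lwcss A B P) (run (lwcss A B P) us) i = query A (run_gaps A xs) i + 2"
    unfolding run by (simp add: lwcss_def)
  have "within_error W (\<epsilon> - 2 / real W) (wfreq W xs (Some i)) (query A (run_gaps A xs) i)"
    using assms(4) by (simp add: solves_WFrequency_gaps_def)
  \<comment> \<open>The slack of 2 absorbs the \<open>+ 2\<close> in the upper bound; in the lower
    bound the \<open>+ 2\<close> pays for the omitted arrivals.\<close>
  moreover have "real W * (\<epsilon> - 2 / real W) = real W * \<epsilon> - 2"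
    using \<open>W > 0\<close> by (simp add: right_diff_distrib)
  ultimately show "within_error W \<epsilon> (wfreq W us i) (query (lwcss A B P) (run (lwcss A B P) us) i)"
    unfolding within_error_def query
    using wfreq_thinning[OF \<open>W > 0\<close> thin, of i] by linarith
qed

end
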